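(* Let $\mathbf{A}=[a_{ij}]$ be an $n\times n$ pairwise comparison matrix. Let $E$, $E_L$, $E_I$ denote the sets of efficient, locally efficient and internally efficient weight vectors with respect to $\mathbf{A}$, and let $WE$, $WE_L$, $WE_I$ denote the sets of weakly efficient, locally weakly efficient and internally weakly efficient weight vectors with respect to $\mathbf{A}$. Then $E=E_L=E_I$ and $WE=WE_L=WE_I$.
   Context: A pairwise comparison matrix of size $n\times n$ ($n\ge 3$) is a real matrix $\mathbf{A}=[a_{ij}]$ with all entries positive and $a_{ij}=1/a_{ji}$ for all $1\le i,j\le n$. Weight vectors are vectors $\mathbf{w}\in\mathbb{R}^n$ with all components positive. Consider the following conditions on positive vectors $\mathbf{w},\mathbf{w}'$. (Dom) $|a_{ij}-w'_i/w'_j|\le|a_{ij}-w_i/w_j|$ for all $1\le i,j\le n$, and $|a_{k\ell}-w'_k/w'_\ell|<|a_{k\ell}-w_k/w_\ell|$ for some $1\le k,\ell\le n$. (IDom) For all $1\le i,j\le n$: $a_{ij}\le w_i/w_j$ implies $a_{ij}\le w'_i/w'_j\le w_i/w_j$, and $a_{ij}\ge w_i/w_j$ implies $a_{ij}\ge w'_i/w'_j\ge w_i/w_j$; and for some $1\le k,\ell\le n$ both implications hold: $a_{k\ell}\le w_k/w_\ell$ implies $w'_k/w'_\ell<w_k/w_\ell$, and $a_{k\ell}\ge w_k/w_\ell$ implies $w'_k/w'_\ell>w_k/w_\ell$. (SDom) $|a_{ij}-w'_i/w'_j|<|a_{ij}-w_i/w_j|$ for all $1\le i\ne j\le n$. (ISDom)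 For all $1\le i\ne j\le n$: $a_{ij}\le w_i/w_j$ implies $a_{ij}\le w'_i/w'_j<w_i/w_j$, and $a_{ij}\ge w_i/w_j$ implies $a_{ij}\ge w'_i/w'_j>w_i/w_j$. A weight vector $\mathbf{w}$ is: efficient if no positive $\mathbf{w}'$ satisfies (Dom); locally efficient if there is a neighborhood $V(\mathbf{w})$ of $\mathbf{w}$ such that no positive $\mathbf{w}'\in V(\mathbf{w})$ satisfies (Dom); internally efficient if no positive $\mathbf{w}'$ satisfies (IDom); weakly efficient if no positive $\mathbf{w}'$ satisfies (SDom); locally weakly efficient if there is a neighborhood $U(\mathbf{w})$ of $\mathbf{w}$ such that no positive $\mathbf{w}'\in U(\mathbf{w})$ satisfies (SDom); internally weakly efficient if no positive $\mathbf{w}'$ satisfies (ISDom). *)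

theory Defs
  imports "HOL-Analysis.Analysis"
begin

text \<open>The size \<open>n\<close> of the matrix is the cardinality of the index type \<open>'n\<close>,
  and \<open>A $ i $ j\<close> is the entry in row \<open>i\<close> and column \<open>j\<close>.\<close>

definition pairwise_comparison_matrix :: "real ^ 'n ^ 'n \<Rightarrow> bool" where
  "pairwise_comparison_matrix A \<longleftrightarrow>
     CARD('n) \<ge> 3 \<and> (\<forall>i j. A $ i $ j > 0) \<and> (\<forall>i j. A $ i $ j = 1 / A $ j $ i)"

definition weight_vector :: "real ^ 'n \<Rightarrow> bool" where
  "weight_vector w \<longleftrightarrow> (\<forall>i. w $ i > 0)"

text \<open>In the four relations below the second vector \<open>w'\<close> is the one that improves on \<open>w\<close>.\<close>

definition dominated_by :: "real ^ 'n ^ 'n \<Rightarrow> real ^ 'n \<Rightarrow> real ^ 'n \<Rightarrow> bool" where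
  "dominated_by A w w' \<longleftrightarrow>
     (\<forall>i j. \<bar>A $ i $ j - w' $ i / w' $ j\<bar> \<le> \<bar>A $ i $ j - w $ i / w $ j\<bar>) \<and>
     (\<exists>k l. \<bar>A $ k $ l - w' $ k / w' $ l\<bar> < \<bar>A $ k $ l - w $ k / w $ l\<bar>)"

definition internally_dominated_by :: "real ^ 'n ^ 'n \<Rightarrow> real ^ 'n \<Rightarrow> real ^ 'n \<Rightarrow> bool" where
  "internally_dominated_by A w w' \<longleftrightarrow>
     (\<forall>i j.
        (A $ i $ j \<le> w $ i / w $ j \<longrightarrow>
           A $ i $ j \<le> w' $ i / w' $ j \<and> w' $ i / w' $ j \<le> w $ i / w $ j) \<and>
        (A $ i $ j \<ge> w $ i / w $ j \<longrightarrow>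
           A $ i $ j \<ge> w' $ i / w' $ j \<and> w' $ i / w' $ j \<ge> w $ i / w $ j)) \<and>
     (\<exists>k l.
        (A $ k $ l \<le> w $ k / w $ l \<longrightarrow> w' $ k / w' $ l < w $ k / w $ l) \<and>
        (A $ k $ l \<ge> w $ k / w $ l \<longrightarrow> w' $ k / w' $ l > w $ k / w $ l))"

definition strictly_dominated_by :: "real ^ 'n ^ 'n \<Rightarrow> real ^ 'n \<Rightarrow> real ^ 'n \<Rightarrow> bool" where
  "strictly_dominated_by A w w' \<longleftrightarrow>
     (\<forall>i j. i \<noteq> j \<longrightarrow>
        \<bar>A $ i $ j - w' $ i / w' $ j\<bar> < \<bar>A $ i $ j - w $ i / w $ j\<bar>)"

definition internally_strictly_dominated_by ::
    "real ^ 'n ^ 'n \<Rightarrow> real ^ 'n \<Rightarrow> real ^ 'n \<Rightarrow> bool" where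
  "internally_strictly_dominated_by A w w' \<longleftrightarrow>
     (\<forall>i j. i \<noteq> j \<longrightarrow>
        (A $ i $ j \<le> w $ i / w $ j \<longrightarrow>
           A $ i $ j \<le> w' $ i / w' $ j \<and> w' $ i / w' $ j < w $ i / w $ j) \<and>
        (A $ i $ j \<ge> w $ i / w $ j \<longrightarrow>
           A $ i $ j \<ge> w' $ i / w' $ j \<and> w' $ i / w' $ j > w $ i / w $ j))"

definition efficient_weights :: "real ^ 'n ^ 'n \<Rightarrow> (real ^ 'n) set" where
  "efficient_weights A =
     {w. weight_vector w \<and> \<not> (\<exists>w'. weight_vector w' \<and> dominated_by A w w')}"

definition locally_efficient_weights :: "real ^ 'n ^ 'n \<Rightarrow> (real ^ 'n) set" where
  "locally_efficient_weights A =
     {w. weight_vector w \<and>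
         (\<exists>V. open V \<and> w \<in> V \<and> \<not> (\<exists>w'\<in>V. weight_vector w' \<and> dominated_by A w w'))}"

definition internally_efficient_weights :: "real ^ 'n ^ 'n \<Rightarrow> (real ^ 'n) set" where
  "internally_efficient_weights A =
     {w. weight_vector w \<and> \<not> (\<exists>w'. weight_vector w' \<and> internally_dominated_by A w w')}"

definition weakly_efficient_weights :: "real ^ 'n ^ 'n \<Rightarrow> (real ^ 'n) set" where
  "weakly_efficient_weights A =
     {w. weight_vector w \<and> \<not> (\<exists>w'. weight_vector w' \<and> strictly_dominated_by A w w')}"

definition locally_weakly_efficient_weights :: "real ^ 'n ^ 'n \<Rightarrow> (real ^ 'n) set" where
  "locally_weakly_efficient_weights A =
     {w. weight_vector w \<and>
         (\<exists>U. open U \<and> w \<in> U \<and> \<not> (\<exists>w'\<in>U. weight_vector w' \<and> strictly_dominated_by A w w'))}"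

definition internally_weakly_efficient_weights :: "real ^ 'n ^ 'n \<Rightarrow> (real ^ 'n) set" where
  "internally_weakly_efficient_weights A =
     {w. weight_vector w \<and>
         \<not> (\<exists>w'. weight_vector w' \<and> internally_strictly_dominated_by A w w')}"

end

theory Submission
  imports Defs
begin

text \<open>If \<open>w'\<close> dominates \<open>w\<close>, then so does \<open>w + t w'\<close> for all small \<open>t > 0\<close>, even internally.
  Each of its ratios is the mediant of the ratios of \<open>w\<close> and \<open>t w'\<close>, hence moves from
  \<open>w\<^sub>i / w\<^sub>j\<close> in the direction of \<open>w'\<^sub>i / w'\<^sub>j\<close>, which is the direction of \<open>a\<^sub>i\<^sub>j\<close>. For small \<open>t\<close> it
  does not overshoot \<open>a\<^sub>i\<^sub>j\<close>. As \<open>w + t w' \<rightarrow> w\<close>, a single \<open>w'\<close> thus refutes all three kinds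
  of efficiency at once.\<close>

lemma mediant_less_iff:
  fixes p q p' q' t :: real
  assumes "q > 0" "q' > 0" "t > 0"
  shows "(p + t * p') / (q + t * q') < p / q \<longleftrightarrow> p' / q' < p / q"
    and "p / q < (p + t * p') / (q + t * q') \<longleftrightarrow> p / q < p' / q'"
proof -
  have pos: "q + t * q' > 0"
    using assms by (simp add: add_pos_pos)
  \<comment> \<open>Clearing the positive denominators leaves \<open>p * q\<close> on both sides;
    once it cancels, every remaining term carries the factor \<open>t\<close>.\<close>
  have "(p + t * p') / (q + t * q') < p / q \<longleftrightarrow> t * (p' * q) < t * (p * q')"
    using assms pos by (simp add: divide_simps algebra_simps)
  then show "(p + t * p') / (q + t * q') < p / q \<longleftrightarrow> p' / q' < p / q"
    using assms by (simp add: divide_simps)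
  have "p / q < (p + t * p') / (q + t * q') \<longleftrightarrow> t * (p * q') < t * (p' * q)"
    using assms pos by (simp add: divide_simps algebra_simps)
  then show "p / q < (p + t * p') / (q + t * q') \<longleftrightarrow> p / q < p' / q'"
    using assms by (simp add: divide_simps)
qed

lemma tendsto_mediant:
  fixes p q p' q' :: real
  assumes "q > 0"
  shows "((\<lambda>t. (p + t * p') / (q + t * q')) \<longlongrightarrow> p / q) (at_right 0)"
  by (rule tendsto_eq_intros refl | use assms in simp)+

text \<open>A ratio \<open>p' / q'\<close> no farther from \<open>a\<close> than
  \<open>p / q\<close>, yet different from it, lies on the side of \<open>p / q\<close> that faces
  \<open>a\<close>. The mediant moves to that side, and its limit \<open>p / q\<close> keeps it from
  passing \<open>a\<close> when \<open>t\<close> is small.\<close>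

lemma eventually_mediant_strict:
  fixes p q p' q' a :: real
  assumes "q > 0" "q' > 0"
    and closer: "\<bar>a - p' / q'\<bar> \<le> \<bar>a - p / q\<bar>" and neq: "p' / q' \<noteq> p / q"
  shows "\<forall>\<^sub>F t in at_right 0.
    (a \<le> p / q \<longrightarrow> a \<le> (p + t * p') / (q + t * q') \<and> (p + t * p') / (q + t * q') < p / q) \<and>
    (a \<ge> p / q \<longrightarrow> a \<ge> (p + t * p') / (q + t * q') \<and> (p + t * p') / (q + t * q') > p / q)"
proof (cases "a < p / q")
  case True
  then have less: "p' / q' < p / q"
    using closer neq by linarith
  have "\<forall>\<^sub>F t in at_right 0. a < (p + t * p') / (q + t * q')"
    by (rule order_tendstoD(1)[OF tendsto_mediant[OF assms(1)] True])
  with eventually_at_right_less[of 0] show ?thesis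
  proof eventually_elim
    case (elim t)
    then show ?case
      using mediant_less_iff(1)[of q q' t p p'] assms(1,2) less True by linarith
  qed
next
  case False
  \<comment> \<open>The case \<open>a = p / q\<close> cannot occur: \<open>closer\<close> would
    force \<open>p' / q' = p / q\<close>, against \<open>neq\<close>.\<close>
  then have less: "p / q < a" "p / q < p' / q'"
    using closer neq by linarith+
  have "\<forall>\<^sub>F t in at_right 0. (p + t * p') / (q + t * q') < a"
    by (rule order_tendstoD(2)[OF tendsto_mediant[OF assms(1)] less(1)])
  with eventually_at_right_less[of 0] show ?thesis
  proof eventually_elim
    case (elim t)
    then show ?case
      using mediant_less_iff(2)[of q q' t p p'] assms(1,2) less by linarith
  qed
qed

text \<open>If both ratios agree, the mediant equals them and nothing moves. This covers diagonal
  entries and pairs with \<open>a = p / q\<close>.\<close>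

lemma eventually_mediant:
  fixes p q p' q' a :: real
  assumes "q > 0" "q' > 0" and closer: "\<bar>a - p' / q'\<bar> \<le> \<bar>a - p / q\<bar>"
  shows "\<forall>\<^sub>F t in at_right 0.
    (a \<le> p / q \<longrightarrow> a \<le> (p + t * p') / (q + t * q') \<and> (p + t * p') / (q + t * q') \<le> p / q) \<and>
    (a \<ge> p / q \<longrightarrow> a \<ge> (p + t * p') / (q + t * q') \<and> (p + t * p') / (q + t * q') \<ge> p / q)"
proof (cases "p' / q' = p / q")
  case True
  show ?thesis
    using eventually_at_right_less[of 0]
  proof eventually_elim
    case (elim t)
    then show ?case
      using mediant_less_iff[of q q' t p p'] assms(1,2) True by linarith
  qed
next
  case False
  from eventually_mediant_strict[OF assms False] show ?thesis
    by eventually_elim auto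
qed

lemma internally_dominated_imp_dominated:
  assumes "internally_dominated_by A w w'"
  shows "dominated_by A w w'"
  unfolding dominated_by_def
proof (intro conjI allI)
  fix i j
  show "\<bar>A $ i $ j - w' $ i / w' $ j\<bar> \<le> \<bar>A $ i $ j - w $ i / w $ j\<bar>"
    using assms unfolding internally_dominated_by_def by (smt (verit))
next
  \<comment> \<open>If the entry at the given \<open>k\<close>, \<open>l\<close> equalled the ratio
    of \<open>w\<close>, the two implications would contradict each other. So exactly one applies,
    and since the new ratio does not pass the entry, the strict move is a strict gain.\<close>
  show "\<exists>k l. \<bar>A $ k $ l - w' $ k / w' $ l\<bar> < \<bar>A $ k $ l - w $ k / w $ l\<bar>"
    using assms unfolding internally_dominated_by_def by (smt (verit))
qed

lemma internally_strictly_dominated_imp_strictly_dominated: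
  assumes "internally_strictly_dominated_by A w w'"
  shows "strictly_dominated_by A w w'"
  using assms unfolding internally_strictly_dominated_by_def strictly_dominated_by_def
  by (smt (verit))

lemma eventually_internally_dominated:
  fixes A :: "real ^ 'n ^ 'n"
  assumes "weight_vector w" "weight_vector w'" "dominated_by A w w'"
  shows "\<forall>\<^sub>F t in at_right 0. internally_dominated_by A w (w + t *\<^sub>R w')"
proof -
  have pos: "w $ i > 0" "w' $ i > 0" for i
    using assms by (auto simp: weight_vector_def)
  obtain k l where kl: "\<bar>A $ k $ l - w' $ k / w' $ l\<bar> < \<bar>A $ k $ l - w $ k / w $ l\<bar>"
    using assms by (auto simp: dominated_by_def)
  have neq: "w' $ k / w' $ l \<noteq> w $ k / w $ l"
    using kl by auto
  have le: "\<bar>A $ i $ j - w' $ i / w' $ j\<bar> \<le> \<bar>A $ i $ j - w $ i / w $ j\<bar>" for i j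
    using assms by (auto simp: dominated_by_def)
  \<comment> \<open>There are finitely many index pairs, so all entries share a range of small
    \<open>t\<close>.\<close>
  note all = eventually_all_finite[OF eventually_all_finite[OF eventually_mediant[OF pos le]]]
  show ?thesis
    using all eventually_mediant_strict[OF pos le neq]
    by eventually_elim (auto simp: internally_dominated_by_def)
qed

lemma eventually_internally_strictly_dominated:
  fixes A :: "real ^ 'n ^ 'n"
  assumes "weight_vector w" "weight_vector w'" "strictly_dominated_by A w w'"
  shows "\<forall>\<^sub>F t in at_right 0. internally_strictly_dominated_by A w (w + t *\<^sub>R w')"
proof -
  have pos: "w $ i > 0" "w' $ i > 0" for i
    using assms by (auto simp: weight_vector_def)
  \<comment> \<open>Keeping \<open>i \<noteq> j\<close> under the eventuality makes the diagonal
    trivial and lets the quantifiers over all indices be pulled inside.\<close>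
  have "\<forall>\<^sub>F t in at_right 0. i \<noteq> j \<longrightarrow>
      (A $ i $ j \<le> w $ i / w $ j \<longrightarrow>
         A $ i $ j \<le> (w + t *\<^sub>R w') $ i / (w + t *\<^sub>R w') $ j \<and>
         (w + t *\<^sub>R w') $ i / (w + t *\<^sub>R w') $ j < w $ i / w $ j) \<and>
      (A $ i $ j \<ge> w $ i / w $ j \<longrightarrow>
         A $ i $ j \<ge> (w + t *\<^sub>R w') $ i / (w + t *\<^sub>R w') $ j \<and>
         (w + t *\<^sub>R w') $ i / (w + t *\<^sub>R w') $ j > w $ i / w $ j)" for i j
  proof (cases "i = j")
    case False
    then have closer: "\<bar>A $ i $ j - w' $ i / w' $ j\<bar> < \<bar>A $ i $ j - w $ i / w $ j\<bar>"
      using assms by (auto simp: strictly_dominated_by_def)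
    then have "w' $ i / w' $ j \<noteq> w $ i / w $ j"
      by auto
    from eventually_mediant_strict[OF pos less_imp_le[OF closer] this] show ?thesis
      by eventually_elim simp
  qed simp
  then show ?thesis
    unfolding internally_strictly_dominated_by_def by (intro eventually_all_finite)
qed

text \<open>The filter \<open>at_right 0\<close> is nontrivial, so membership in \<open>V\<close>,
  positivity and \<open>P\<close>, each eventually true, hold together for some
  \<open>t\<close>.\<close>

lemma exists_perturbed_weight_vector:
  fixes w w' :: "real ^ 'n"
  assumes "weight_vector w" "weight_vector w'" "open V" "w \<in> V"
    and "\<forall>\<^sub>F t in at_right 0. P (w + t *\<^sub>R w')"
  shows "\<exists>v\<in>V. weight_vector v \<and> P v"
proof -
  have "((\<lambda>t. w + t *\<^sub>R w') \<longlongrightarrow> w) (at_right 0)"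
    by (rule tendsto_eq_intros refl | simp)+
  then have "\<forall>\<^sub>F t in at_right 0. w + t *\<^sub>R w' \<in> V"
    using assms(3,4) by (rule topological_tendstoD)
  with assms(5) eventually_at_right_less[of 0]
  have "\<forall>\<^sub>F t in at_right 0. w + t *\<^sub>R w' \<in> V \<and> weight_vector (w + t *\<^sub>R w') \<and> P (w + t *\<^sub>R w')"
    by eventually_elim (use assms(1,2) in \<open>auto simp: weight_vector_def add_pos_pos\<close>)
  then show ?thesis
    using eventually_happens'[OF trivial_limit_at_right_real] by blast
qed

text \<open>Arbitrary \<open>V\<close> serves local efficiency, \<open>V = UNIV\<close> internal
  efficiency.\<close>

lemma dominated_imp_internally_dominated_nearby:
  fixes A :: "real ^ 'n ^ 'n"
  assumes "weight_vector w" "weight_vector w'" "dominated_by A w w'" "open V" "w \<in> V"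
  shows "\<exists>v\<in>V. weight_vector v \<and> internally_dominated_by A w v"
  by (rule exists_perturbed_weight_vector[OF assms(1,2,4,5)
        eventually_internally_dominated[OF assms(1-3)]])

lemma strictly_dominated_imp_internally_strictly_dominated_nearby:
  fixes A :: "real ^ 'n ^ 'n"
  assumes "weight_vector w" "weight_vector w'" "strictly_dominated_by A w w'" "open V" "w \<in> V"
  shows "\<exists>v\<in>V. weight_vector v \<and> internally_strictly_dominated_by A w v"
  by (rule exists_perturbed_weight_vector[OF assms(1,2,4,5)
        eventually_internally_strictly_dominated[OF assms(1-3)]])

theorem proposition2p2:
  fixes A :: "real ^ 'n ^ 'n"
  assumes "pairwise_comparison_matrix A"
  shows "efficient_weights A = locally_efficient_weights A \<and>
         locally_efficient_weights A = internally_efficient_weights A \<and>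
         weakly_efficient_weights A = locally_weakly_efficient_weights A \<and>
         locally_weakly_efficient_weights A = internally_weakly_efficient_weights A"
proof -
  note near = dominated_imp_internally_dominated_nearby[where A = A]
  note strictly_near = strictly_dominated_imp_internally_strictly_dominated_nearby[where A = A]
  \<comment> \<open>A dominating vector anywhere yields one in every neighborhood of
    \<open>w\<close>; conversely, for efficient \<open>w\<close> the neighborhood
    \<open>UNIV\<close> is a witness.\<close>
  have "w \<in> efficient_weights A \<longleftrightarrow> w \<in> locally_efficient_weights A" for w
    unfolding efficient_weights_def locally_efficient_weights_def mem_Collect_eq
    by (metis near internally_dominated_imp_dominated open_UNIV UNIV_I)
  moreover have "w \<in> efficient_weights A \<longleftrightarrow> w \<in> internally_efficient_weights A" for w
    unfolding efficient_weights_def internally_efficient_weights_def mem_Collect_eq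
    by (metis near internally_dominated_imp_dominated open_UNIV UNIV_I)
  moreover have "w \<in> weakly_efficient_weights A \<longleftrightarrow> w \<in> locally_weakly_efficient_weights A" for w
    unfolding weakly_efficient_weights_def locally_weakly_efficient_weights_def mem_Collect_eq
    by (metis strictly_near internally_strictly_dominated_imp_strictly_dominated open_UNIV UNIV_I)
  moreover have "w \<in> weakly_efficient_weights A \<longleftrightarrow> w \<in> internally_weakly_efficient_weights A" for w
    unfolding weakly_efficient_weights_def internally_weakly_efficient_weights_def mem_Collect_eq
    by (metis strictly_near internally_strictly_dominated_imp_strictly_dominated open_UNIV UNIV_I)
  ultimately show ?thesis
    by (simp add: set_eq_iff)
qed

end
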